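(* Let $F$ be a formula in 2-XNF in the variables $X_1,\dots,X_n$, and let $(L,V,E)$ be an implication graph structure for $F$. (a) For all $f\in V$ and $g\in\Delta_f$, we have $(f+1)g\in I_F$. (b) Let $f,g\in V$. If $\Delta_f\cap(1+\Delta_g)\neq\emptyset$, then $(f+1)(g+1)\in I_F$. (c) For all $f\in V$, we have $\Delta_f\cap\Delta_{f+1}\subseteq I_F$.
   Context: $\mathbb{B}_n=\mathbb{F}_2[X_1,\dots,X_n]/\langle X_1^2-X_1,\dots,X_n^2-X_n\rangle$ is the ring of Boolean polynomials, $x_i$ the residue class of $X_i$, and $\mathbb{L}_n=\langle 1,x_1,\dots,x_n\rangle_{\mathbb{F}_2}$ the space of linear Boolean polynomials. A lineral is an XOR of literals; a formula is in 2-XNF if it is a conjunction of clauses each of which is a disjunction of at most two linerals. For such a formula $F$ in $X_1,\dots,X_n$ (true $=1$, false $=0$), $I_F\subseteq\mathbb{B}_n$ is the unique ideal whose zero set $\mathcal{Z}(I_F)\subseteq\mathbb{F}_2^n$ equals the set of satisfying assignments of $F$. An implication graph structure (IGS) for $F$ is a tuple $(L,V,E)$ with $L,V\subseteq\mathbb{L}_n$ and $E\subseteq V^2$ such that (1) $I_F=\langle L\rangle+\langle fg\mid (f+1,g)\in E\rangle$; (2) for all $(f+1,g)\in E$ we have $(g+1,f)\in E$; (3) for all $f\in V$, $(f,f)\notin E$. A path $f\to g$ is a sequence $f=f_1,\dots,f_s=g$ in $V$ with $(f_i,f_{i+1})\in E$ for $1\le i\le s-1$. The set of descendants of $f$ is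 $D_f=\{f\}\cup\{g\in V\mid \text{there is a path } f\to g \text{ in }(V,E)\}$, and $\Delta_f=\langle D_f\rangle_{\mathbb{F}_2}\subseteq\mathbb{L}_n$ is the space of descendants of $f$. The same formulas define $D_{f+1}$ and $\Delta_{f+1}$ (with $D_{f+1}=\{f+1\}$ if $f+1\notin V$). For a subspace $U\subseteq\mathbb{L}_n$, $1+U=\{u+1\mid u\in U\}$. *)

theory Defs
  imports Complex_Main "HOL-Library.FuncSet" "HOL-Library.Poly_Mapping" "HOL-Library.Z2"
begin

section \<open>Boolean polynomials\<close>

text \<open>
  The variables are indexed by a type \<open>'n\<close>; where the number of variables has to be finite,
  \<open>'n\<close> is required to be of class \<^class>\<open>finite\<close>, and then \<open>n = CARD('n)\<close>.
  A polynomial over \<open>\<bbbF>\<^sub>2\<close> maps exponent vectors to coefficients, with finite support.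
\<close>

type_synonym 'n mpoly2 = "('n \<Rightarrow>\<^sub>0 nat) \<Rightarrow>\<^sub>0 bit"

definition mvar :: "'n \<Rightarrow> 'n mpoly2" where
  "mvar i = Poly_Mapping.single (Poly_Mapping.single i 1) 1"

definition mpoly_eval :: "('n \<Rightarrow> bit) \<Rightarrow> 'n mpoly2 \<Rightarrow> bit" where
  "mpoly_eval a p = (\<Sum>m\<in>Poly_Mapping.keys p.
     Poly_Mapping.lookup p m * (\<Prod>i\<in>Poly_Mapping.keys m. a i ^ Poly_Mapping.lookup m i))"

lemma mpoly_eval_superset:
  assumes "finite S" "Poly_Mapping.keys p \<subseteq> S"
  shows "mpoly_eval a p = (\<Sum>m\<in>S.
     Poly_Mapping.lookup p m * (\<Prod>i\<in>Poly_Mapping.keys m. a i ^ Poly_Mapping.lookup m i))"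
  unfolding mpoly_eval_def using assms
  by (intro sum.mono_neutral_left) (auto simp: in_keys_iff simp del: bit_not_zero_iff)

lemma monom_val_superset:
  fixes a :: "'n \<Rightarrow> bit" and m :: "'n \<Rightarrow>\<^sub>0 nat"
  assumes "finite S" "Poly_Mapping.keys m \<subseteq> S"
  shows "(\<Prod>i\<in>Poly_Mapping.keys m. a i ^ Poly_Mapping.lookup m i) =
    (\<Prod>i\<in>S. a i ^ Poly_Mapping.lookup m i)"
  using assms by (intro prod.mono_neutral_left) (auto simp: in_keys_iff simp del: power_bit_unfold)

lemma monom_val_add:
  fixes a :: "'n \<Rightarrow> bit" and m m' :: "'n \<Rightarrow>\<^sub>0 nat"
  shows "(\<Prod>i\<in>Poly_Mapping.keys (m + m'). a i ^ Poly_Mapping.lookup (m + m') i) =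
    (\<Prod>i\<in>Poly_Mapping.keys m. a i ^ Poly_Mapping.lookup m i) *
    (\<Prod>i\<in>Poly_Mapping.keys m'. a i ^ Poly_Mapping.lookup m' i)"
proof -
  let ?S = "Poly_Mapping.keys m \<union> Poly_Mapping.keys m'"
  have fin: "finite ?S" by simp
  have sub: "Poly_Mapping.keys (m + m') \<subseteq> ?S" by (rule Poly_Mapping.keys_add)
  show ?thesis
    unfolding monom_val_superset[OF fin sub] monom_val_superset[OF fin Un_upper1]
      monom_val_superset[OF fin Un_upper2]
    by (simp only: lookup_add power_add prod.distrib)
qed

lemma mpoly_eval_0 [simp]: "mpoly_eval a 0 = 0"
  by (simp add: mpoly_eval_def)

lemma mpoly_eval_single:
  "mpoly_eval a (Poly_Mapping.single m c) =
     c * (\<Prod>i\<in>Poly_Mapping.keys m. a i ^ Poly_Mapping.lookup m i)"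
  by (subst mpoly_eval_superset[of "{m}"]) (auto simp del: power_bit_unfold)

lemma mpoly_eval_1 [simp]: "mpoly_eval a 1 = 1"
  by (simp add: mpoly_eval_single flip: single_one)

lemma mpoly_eval_mvar [simp]: "mpoly_eval a (mvar i) = a i"
  by (simp add: mvar_def mpoly_eval_single del: power_bit_unfold)

lemma mpoly_eval_add [simp]: "mpoly_eval a (p + q) = mpoly_eval a p + mpoly_eval a q"
proof -
  let ?S = "Poly_Mapping.keys p \<union> Poly_Mapping.keys q"
  have fin: "finite ?S" by simp
  have sub: "Poly_Mapping.keys (p + q) \<subseteq> ?S" by (rule Poly_Mapping.keys_add)
  show ?thesis
    unfolding mpoly_eval_superset[OF fin sub] mpoly_eval_superset[OF fin Un_upper1]
      mpoly_eval_superset[OF fin Un_upper2]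
    by (simp only: lookup_add distrib_right sum.distrib)
qed

lemma mpoly_eval_uminus [simp]: "mpoly_eval a (- p) = - mpoly_eval a p"
proof -
  have "mpoly_eval a p + mpoly_eval a (- p) = 0" by (metis mpoly_eval_add mpoly_eval_0 add.right_inverse)
  then show ?thesis by (metis minus_unique)
qed

lemma mpoly_eval_diff [simp]: "mpoly_eval a (p - q) = mpoly_eval a p - mpoly_eval a q"
  using mpoly_eval_add[of a p "- q"] by simp

lemma mpoly_induct [case_names zero add]:
  fixes p :: "'n mpoly2"
  assumes "P 0" "\<And>m c p. P p \<Longrightarrow> P (Poly_Mapping.single m c + p)"
  shows "P p"
proof -
  have "P (\<Sum>m\<in>S. Poly_Mapping.single m (Poly_Mapping.lookup p m))" if "finite S" for S
    using that by induction (simp_all add: assms)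
  moreover have "p = (\<Sum>m\<in>Poly_Mapping.keys p. Poly_Mapping.single m (Poly_Mapping.lookup p m))"
    by (rule poly_mapping_eqI)
      (auto simp: lookup_sum lookup_single when_def sum.delta in_keys_iff simp del: bit_not_zero_iff)
  ultimately show ?thesis by (metis finite_keys)
qed

lemma mpoly_eval_mult [simp]: "mpoly_eval a (p * q) = mpoly_eval a p * mpoly_eval a q"
proof (induction p rule: mpoly_induct)
  case (add m c p)
  have "mpoly_eval a (Poly_Mapping.single m c * q) =
      mpoly_eval a (Poly_Mapping.single m c) * mpoly_eval a q"
  proof (induction q rule: mpoly_induct)
    case (add m' c' q)
    then show ?case
      by (simp only: distrib_left mpoly_eval_add mult_single mpoly_eval_single monom_val_add ac_simps)
  qed simp
  with add show ?case
    by (simp only: distrib_right mpoly_eval_add)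
qed simp

text \<open>
  Every commutative ring is a module over itself: \<open>ring_mod.subspace I\<close> says that \<open>I\<close> is an
  ideal, and \<open>ring_mod.span S\<close> is the ideal generated by \<open>S\<close>.
\<close>

global_interpretation ring_mod: module "(*) :: 'a::comm_ring_1 \<Rightarrow> 'a \<Rightarrow> 'a"
  by standard (simp_all add: algebra_simps)

definition field_eqs :: "'n mpoly2 set" where
  "field_eqs = range (\<lambda>i. mvar i ^ 2 - mvar i)"

lemma mpoly_eval_field_eqs:
  assumes "p \<in> ring_mod.span field_eqs"
  shows "mpoly_eval a p = 0"
  using assms
  by (induction rule: ring_mod.span_induct_alt) (auto simp: field_eqs_def power2_eq_square)

quotient_type 'n bpoly = "'n mpoly2" / "\<lambda>p q. p - q \<in> ring_mod.span field_eqs"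
proof (rule equivpI)
  show "reflp (\<lambda>p q :: 'n mpoly2. p - q \<in> ring_mod.span field_eqs)"
    by (auto intro: reflpI simp: ring_mod.span_zero)
  show "symp (\<lambda>p q :: 'n mpoly2. p - q \<in> ring_mod.span field_eqs)"
    by (metis (mono_tags, lifting) sympI minus_diff_eq ring_mod.span_neg)
  show "transp (\<lambda>p q :: 'n mpoly2. p - q \<in> ring_mod.span field_eqs)"
  proof (rule transpI)
    fix p q r :: "'n mpoly2"
    assume "p - q \<in> ring_mod.span field_eqs" "q - r \<in> ring_mod.span field_eqs"
    then have "(p - q) + (q - r) \<in> ring_mod.span field_eqs"
      by (rule ring_mod.span_add)
    then show "p - r \<in> ring_mod.span field_eqs" by simp
  qed
qed

instantiation bpoly :: (type) comm_ring_1
begin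

lift_definition zero_bpoly :: "'a bpoly" is 0 .

lift_definition one_bpoly :: "'a bpoly" is 1 .

lift_definition plus_bpoly :: "'a bpoly \<Rightarrow> 'a bpoly \<Rightarrow> 'a bpoly" is "(+)"
  by (metis add_diff_add ring_mod.span_add)

lift_definition uminus_bpoly :: "'a bpoly \<Rightarrow> 'a bpoly" is uminus
  by (metis minus_diff_minus ring_mod.span_neg)

lift_definition minus_bpoly :: "'a bpoly \<Rightarrow> 'a bpoly \<Rightarrow> 'a bpoly" is "(-)"
proof -
  fix p p' q q' :: "'a mpoly2"
  assume "p - p' \<in> ring_mod.span field_eqs" "q - q' \<in> ring_mod.span field_eqs"
  then have "(p - p') - (q - q') \<in> ring_mod.span field_eqs"
    by (rule ring_mod.span_diff)
  then show "p - q - (p' - q') \<in> ring_mod.span field_eqs"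
    by (simp add: algebra_simps)
qed

lift_definition times_bpoly :: "'a bpoly \<Rightarrow> 'a bpoly \<Rightarrow> 'a bpoly" is "(*)"
proof -
  fix p p' q q' :: "'a mpoly2"
  assume "p - p' \<in> ring_mod.span field_eqs" "q - q' \<in> ring_mod.span field_eqs"
  then have "q * (p - p') + p' * (q - q') \<in> ring_mod.span field_eqs"
    by (intro ring_mod.span_add ring_mod.span_scale)
  then show "p * q - p' * q' \<in> ring_mod.span field_eqs"
    by (simp add: algebra_simps)
qed

instance
proof
  fix p q r :: "'a bpoly"
  have eq: "x - y \<in> ring_mod.span field_eqs" if "x = y" for x y :: "'a mpoly2"
    using that by (simp add: ring_mod.span_zero)
  show "p * q * r = p * (q * r)" by transfer (rule eq, rule mult.assoc)
  show "p * q = q * p" by transfer (rule eq, rule mult.commute)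
  show "1 * p = p" by transfer (rule eq, rule mult_1_left)
  show "p + q + r = p + (q + r)" by transfer (rule eq, rule add.assoc)
  show "p + q = q + p" by transfer (rule eq, rule add.commute)
  show "0 + p = p" by transfer (rule eq, rule add_0_left)
  show "- p + p = 0" by transfer (rule eq, rule left_minus)
  show "p - q = p + - q" by transfer (rule eq, rule diff_conv_add_uminus)
  show "(p + q) * r = p * r + q * r" by transfer (rule eq, rule distrib_right)
  show "(0 :: 'a bpoly) \<noteq> 1"
  proof (transfer, rule notI)
    assume "0 - (1 :: 'a mpoly2) \<in> ring_mod.span field_eqs"
    then have "mpoly_eval (\<lambda>_. 0) (0 - (1 :: 'a mpoly2)) = 0"
      by (rule mpoly_eval_field_eqs)
    then show False by (simp only: mpoly_eval_diff mpoly_eval_0 mpoly_eval_1) simp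
  qed
qed

end

lift_definition bvar :: "'n \<Rightarrow> 'n bpoly" is mvar .

lift_definition bscale :: "bit \<Rightarrow> 'n bpoly \<Rightarrow> 'n bpoly"
  is "\<lambda>c p. Poly_Mapping.single 0 c * p"
  by (metis right_diff_distrib ring_mod.span_scale)

global_interpretation bpoly_vs: vector_space bscale
proof
  fix a b :: bit and x y :: "'n bpoly"
  show "bscale a (x + y) = bscale a x + bscale a y"
    by transfer (simp add: algebra_simps ring_mod.span_zero)
  show "bscale (a + b) x = bscale a x + bscale b x"
    by transfer (simp only: single_add distrib_right diff_self ring_mod.span_zero)
  show "bscale a (bscale b x) = bscale (a * b) x"
    by transfer (simp add: ring_mod.span_zero mult_single flip: mult.assoc)
  show "bscale 1 x = x"
    by transfer (simp add: ring_mod.span_zero)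
qed

lift_definition bpoly_eval :: "('n \<Rightarrow> bit) \<Rightarrow> 'n bpoly \<Rightarrow> bit" is mpoly_eval
proof -
  fix a and p q :: "'n mpoly2"
  assume "p - q \<in> ring_mod.span field_eqs"
  then have "mpoly_eval a p - mpoly_eval a q = 0"
    by (metis mpoly_eval_field_eqs mpoly_eval_diff)
  then show "mpoly_eval a p = mpoly_eval a q" by (simp only: right_minus_eq)
qed

definition zero_set :: "'n bpoly set \<Rightarrow> ('n \<Rightarrow> bit) set" where
  "zero_set I = {a. \<forall>p\<in>I. bpoly_eval a p = 0}"

definition linear_bpolys :: "'n::finite bpoly set" where
  "linear_bpolys = bpoly_vs.span (insert 1 (range bvar))"


section \<open>Formulas in 2-XNF and their ideals\<close>

datatype 'n literal = Pos 'n | Neg 'n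

text \<open>A list of literals stands for its XOR, a list of linerals for its disjunction,
  and a list of clauses for its conjunction.\<close>

type_synonym 'n lineral = "'n literal list"
type_synonym 'n xclause = "'n lineral list"
type_synonym 'n xnf = "'n xclause list"

fun literal_val :: "('n \<Rightarrow> bit) \<Rightarrow> 'n literal \<Rightarrow> bit" where
  "literal_val a (Pos i) = a i"
| "literal_val a (Neg i) = a i + 1"

definition lineral_val :: "('n \<Rightarrow> bit) \<Rightarrow> 'n lineral \<Rightarrow> bit" where
  "lineral_val a l = (\<Sum>x\<leftarrow>l. literal_val a x)"

definition satisfies :: "('n \<Rightarrow> bit) \<Rightarrow> 'n xnf \<Rightarrow> bool" where
  "satisfies a F \<longleftrightarrow> (\<forall>C\<in>set F. \<exists>l\<in>set C. lineral_val a l = 1)"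

definition is_2xnf :: "'n xnf \<Rightarrow> bool" where
  "is_2xnf F \<longleftrightarrow> (\<forall>C\<in>set F. length C \<le> 2)"

definition xnf_ideal :: "'n::finite xnf \<Rightarrow> 'n bpoly set" where
  "xnf_ideal F = (THE I. ring_mod.subspace I \<and> zero_set I = {a. satisfies a F})"

text \<open>The description in \<^const>\<open>xnf_ideal\<close> is proper: over finitely many variables, the ideals
  of \<open>\<bbbB>\<^sub>n\<close> are in bijection with the subsets of \<open>\<bbbF>\<^sub>2\<^sup>n\<close>.\<close>

lemma bpoly_eval_simps [simp]:
  "bpoly_eval a 0 = 0" "bpoly_eval a 1 = 1" "bpoly_eval a (bvar i) = a i"
  "bpoly_eval a (p + q) = bpoly_eval a p + bpoly_eval a q"
  "bpoly_eval a (p * q) = bpoly_eval a p * bpoly_eval a q"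
  by (transfer; simp)+

lemma bpoly_eval_sum: "bpoly_eval a (sum f S) = (\<Sum>x\<in>S. bpoly_eval a (f x))"
  by (induction S rule: infinite_finite_induct) auto

lemma bpoly_eval_prod: "bpoly_eval a (prod f S) = (\<Prod>x\<in>S. bpoly_eval a (f x))"
  by (induction S rule: infinite_finite_induct) auto

lemma bpoly_char2: "p + p = (0 :: 'n bpoly)"
proof -
  have "p + p = bscale 1 p + bscale 1 p" by simp
  also have "\<dots> = bscale (1 + 1) p" by (simp only: bpoly_vs.scale_left_distrib)
  finally show ?thesis by (simp only: one_add_one bit_2_eq_0 bpoly_vs.scale_zero_left)
qed

lemma bvar_idem: "bvar i * bvar i = bvar i"
  by transfer (auto simp: field_eqs_def power2_eq_square intro!: ring_mod.span_base)

lemma monom_induct [case_names zero var]: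
  fixes m :: "'n \<Rightarrow>\<^sub>0 nat"
  assumes "P 0" "\<And>m i. P m \<Longrightarrow> P (Poly_Mapping.single i 1 + m)"
  shows "P m"
proof (induction "\<Sum>i\<in>Poly_Mapping.keys m. Poly_Mapping.lookup m i" arbitrary: m)
  case 0
  then have "m = 0" by (auto simp: in_keys_iff simp flip: keys_eq_empty)
  with assms show ?case by simp
next
  case (Suc k)
  then have "Poly_Mapping.keys m \<noteq> {}" by auto
  then obtain i where i: "i \<in> Poly_Mapping.keys m" by blast
  define m' where "m' = m - Poly_Mapping.single i 1"
  have m: "m = Poly_Mapping.single i 1 + m'"
    using i by (auto intro!: poly_mapping_eqI simp: m'_def lookup_add lookup_minus lookup_single when_def in_keys_iff)
  have "(\<Sum>j\<in>Poly_Mapping.keys m. Poly_Mapping.lookup m' j) = k"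
  proof -
    have "Suc k = (\<Sum>j\<in>Poly_Mapping.keys m. (if i = j then 1 else 0) + Poly_Mapping.lookup m' j)"
      unfolding Suc(2) by (rule sum.cong) (auto simp: m lookup_add lookup_single when_def)
    then show ?thesis using i by (simp add: sum.distrib)
  qed
  moreover have "(\<Sum>j\<in>Poly_Mapping.keys m'. Poly_Mapping.lookup m' j) =
     (\<Sum>j\<in>Poly_Mapping.keys m. Poly_Mapping.lookup m' j)"
    by (rule sum.mono_neutral_left) (auto simp: m'_def in_keys_iff lookup_minus)
  ultimately show ?case using Suc(1)[of m'] assms(2) m by metis
qed

lemma bpoly_induct [case_names zero one add var]:
  fixes p :: "'n bpoly"
  assumes zero: "P 0" and one: "P 1" and add: "\<And>p q. P p \<Longrightarrow> P q \<Longrightarrow> P (p + q)"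
    and var: "\<And>i p. P p \<Longrightarrow> P (bvar i * p)"
  shows "P p"
proof -
  have abs: "abs_bpoly (p + q) = abs_bpoly p + abs_bpoly q"
    "abs_bpoly (p * q) = abs_bpoly p * abs_bpoly q" for p q :: "'n mpoly2"
    by (simp_all add: plus_bpoly.abs_eq times_bpoly.abs_eq)
  have mon: "P (abs_bpoly (Poly_Mapping.single m 1))" for m
  proof (induction m rule: monom_induct)
    case zero
    show ?case using one by (simp only: one_bpoly.abs_eq single_one)
  next
    case (var m i)
    have "abs_bpoly (Poly_Mapping.single (Poly_Mapping.single i 1 + m) 1) =
        bvar i * abs_bpoly (Poly_Mapping.single m 1)"
      by (simp only: bvar.abs_eq mvar_def abs(2)[symmetric] mult_single mult_1)
    with var show ?case using assms(4) by simp
  qed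
  have "P (abs_bpoly q)" for q
  proof (induction q rule: mpoly_induct)
    case zero
    show ?case using assms(1) by (simp only: zero_bpoly.abs_eq)
  next
    case (add m c q)
    show ?case
    proof (cases "c = 0")
      case True
      then show ?thesis using add by simp
    next
      case False
      then have "c = 1" by simp
      then show ?thesis unfolding abs using assms(3)[OF mon add] by simp
    qed
  qed
  then show ?thesis by (rule bpoly.abs_induct)
qed

definition point_bpoly :: "('n::finite \<Rightarrow> bit) \<Rightarrow> 'n bpoly" where
  "point_bpoly a = (\<Prod>i\<in>UNIV. if a i = 1 then bvar i else 1 + bvar i)"

lemma bpoly_eval_point: "bpoly_eval b (point_bpoly a) = (if b = a then 1 else 0)"
proof (cases "b = a")
  case True
  then show ?thesis
    by (auto simp: point_bpoly_def bpoly_eval_prod intro!: prod.neutral)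
next
  case False
  then obtain i where "b i \<noteq> a i" by auto
  then have "bpoly_eval b (if a i = 1 then bvar i else 1 + bvar i) = 0"
    by (cases "a i"; cases "b i") auto
  then have "bpoly_eval b (point_bpoly a) = 0"
    unfolding point_bpoly_def bpoly_eval_prod by (intro prod_zero bexI[of _ i]) simp_all
  with False show ?thesis by simp
qed

lemma mult_point_bpoly:
  "p * point_bpoly a = (if bpoly_eval a p = 1 then point_bpoly a else 0)"
proof (induction p rule: bpoly_induct)
  case (var i p)
  let ?q = "if a i = 1 then bvar i else 1 + bvar i"
  have aux: "x * P = (if b then P else 0)" if "x * q = (if b then q else 0)" "P = q * R"
    for x q P R :: "'n bpoly" and b
    using that by (cases b) (simp_all flip: mult.assoc)
  have "bvar i * (1 + bvar i) = 0"
    by (simp only: distrib_left mult_1_right bvar_idem bpoly_char2)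
  then have "bvar i * ?q = (if a i = 1 then ?q else 0)"
    by (simp only: bvar_idem split: if_split) blast
  moreover have "point_bpoly a = ?q * (\<Prod>i\<in>UNIV - {i}. if a i = 1 then bvar i else 1 + bvar i)"
    unfolding point_bpoly_def by (rule prod.remove) auto
  ultimately have "bvar i * point_bpoly a = (if a i = 1 then point_bpoly a else 0)"
    by (rule aux)
  moreover have "bvar i * p * point_bpoly a =
      (if bpoly_eval a p = 1 then bvar i * point_bpoly a else 0)"
    unfolding mult.assoc var by simp
  ultimately show ?case by simp
next
  case (add p q)
  show ?case
    unfolding distrib_right add
    by (cases "bpoly_eval a p"; cases "bpoly_eval a q") (simp_all add: bpoly_char2)
qed simp_all

lemma points_eq_PiE: "Pi\<^sub>E UNIV (\<lambda>_. {0, 1}) = (UNIV :: ('n \<Rightarrow> bit) set)"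
proof -
  have "x \<in> {0, 1}" for x :: bit
    by (cases x) simp_all
  then show ?thesis unfolding PiE_UNIV_domain by blast
qed

lemma finite_points: "finite (UNIV :: ('n::finite \<Rightarrow> bit) set)"
  unfolding points_eq_PiE[symmetric] by (rule finite_PiE) simp_all

lemma sum_point_bpoly: "(\<Sum>a\<in>UNIV. point_bpoly a) = (1 :: 'n::finite bpoly)"
proof -
  have "(\<Sum>a\<in>UNIV. point_bpoly a) = (\<Sum>a\<in>Pi\<^sub>E UNIV (\<lambda>_. {0, 1}). point_bpoly (a :: 'n \<Rightarrow> bit))"
    by (simp only: points_eq_PiE)
  also have "\<dots> = (\<Prod>i::'n\<in>UNIV. \<Sum>c\<in>{0, 1}. if c = (1 :: bit) then bvar i else 1 + bvar i)"
    unfolding point_bpoly_def by (rule prod_sum_PiE[symmetric]) auto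
  also have "\<dots> = (\<Prod>i::'n\<in>UNIV. 1)"
    by (rule prod.cong) (simp_all add: add.assoc bpoly_char2)
  finally show ?thesis by simp
qed

lemma bpoly_expand:
  fixes p :: "'n::finite bpoly"
  shows "p = (\<Sum>a\<in>{a. bpoly_eval a p = 1}. point_bpoly a)"
proof -
  have "p = (\<Sum>a\<in>UNIV. p * point_bpoly a)"
    by (simp add: sum_point_bpoly flip: sum_distrib_left)
  also have "\<dots> = (\<Sum>a\<in>UNIV. if bpoly_eval a p = 1 then point_bpoly a else 0)"
    by (simp only: mult_point_bpoly)
  also have "\<dots> = (\<Sum>a\<in>{a. bpoly_eval a p = 1}. point_bpoly a)"
    using sum.inter_filter[OF finite_points, of point_bpoly "\<lambda>a. bpoly_eval a p = 1"] by simp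
  finally show ?thesis .
qed

lemma ideal_eq_vanishing:
  fixes I :: "'n::finite bpoly set"
  assumes I: "ring_mod.subspace I"
  shows "I = {p. \<forall>a\<in>zero_set I. bpoly_eval a p = 0}"
proof (intro equalityI subsetI)
  fix p assume p: "p \<in> {p. \<forall>a\<in>zero_set I. bpoly_eval a p = 0}"
  have "point_bpoly a \<in> I" if "bpoly_eval a p = 1" for a
  proof -
    have "a \<notin> zero_set I" using p that by auto
    then obtain q where q: "q \<in> I" "bpoly_eval a q = 1" by (auto simp: zero_set_def)
    have "point_bpoly a * q \<in> I" using I q(1) by (rule ring_mod.subspace_scale)
    then show ?thesis using q(2) mult_point_bpoly[of q a] by (simp add: mult.commute)
  qed
  then have "(\<Sum>a\<in>{a. bpoly_eval a p = 1}. point_bpoly a) \<in> I"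
    by (intro ring_mod.subspace_sum[OF I]) simp
  then show "p \<in> I" by (simp only: bpoly_expand[symmetric])
qed (auto simp: zero_set_def)

lemma ex1_ideal_zero_set:
  fixes Z :: "('n::finite \<Rightarrow> bit) set"
  shows "\<exists>!I. ring_mod.subspace I \<and> zero_set I = Z"
proof (rule ex_ex1I)
  let ?I = "{p. \<forall>a\<in>Z. bpoly_eval a p = 0}"
  have "ring_mod.subspace ?I" by (simp add: ring_mod.subspace_def)
  moreover have "a \<in> Z" if "a \<in> zero_set ?I" for a
  proof (rule ccontr)
    assume "a \<notin> Z"
    then have "point_bpoly a \<in> ?I" by (simp add: bpoly_eval_point) metis
    then have "bpoly_eval a (point_bpoly a) = 0" using that unfolding zero_set_def by blast
    then show False by (simp add: bpoly_eval_point)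
  qed
  moreover have "Z \<subseteq> zero_set ?I" unfolding zero_set_def by blast
  ultimately have "zero_set ?I = Z" "ring_mod.subspace ?I" by blast+
  then show "\<exists>I. ring_mod.subspace I \<and> zero_set I = Z" by blast
next
  fix I J :: "'n bpoly set"
  assume "ring_mod.subspace I \<and> zero_set I = Z" "ring_mod.subspace J \<and> zero_set J = Z"
  then show "I = J" using ideal_eq_vanishing[of I] ideal_eq_vanishing[of J] by simp
qed

lemma xnf_ideal_props:
  "ring_mod.subspace (xnf_ideal F)" "zero_set (xnf_ideal F) = {a. satisfies a F}"
  using theI'[OF ex1_ideal_zero_set, of "{a. satisfies a F}"] unfolding xnf_ideal_def
  by (rule conjunct1, rule conjunct2)


section \<open>Implication graph structures\<close>

definition is_igs ::
  "'n::finite xnf \<Rightarrow> 'n bpoly set \<Rightarrow> 'n bpoly set \<Rightarrow> ('n bpoly \<times> 'n bpoly) set \<Rightarrow> bool" where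
  "is_igs F L V E \<longleftrightarrow>
     L \<subseteq> linear_bpolys \<and> V \<subseteq> linear_bpolys \<and> E \<subseteq> V \<times> V \<and>
     xnf_ideal F = {p + q | p q. p \<in> ring_mod.span L \<and>
                                 q \<in> ring_mod.span {f * g | f g. (f + 1, g) \<in> E}} \<and>
     (\<forall>f g. (f + 1, g) \<in> E \<longrightarrow> (g + 1, f) \<in> E) \<and>
     (\<forall>f\<in>V. (f, f) \<notin> E)"

definition is_path ::
  "'n bpoly set \<Rightarrow> ('n bpoly \<times> 'n bpoly) set \<Rightarrow> 'n bpoly \<Rightarrow> 'n bpoly \<Rightarrow> 'n bpoly list \<Rightarrow> bool" where
  "is_path V E f g fs \<longleftrightarrow>
     fs \<noteq> [] \<and> hd fs = f \<and> last fs = g \<and> set fs \<subseteq> V \<and>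
     (\<forall>i. Suc i < length fs \<longrightarrow> (fs ! i, fs ! Suc i) \<in> E)"

definition descendants ::
  "'n bpoly set \<Rightarrow> ('n bpoly \<times> 'n bpoly) set \<Rightarrow> 'n bpoly \<Rightarrow> 'n bpoly set" where
  "descendants V E f = {f} \<union> {g \<in> V. \<exists>fs. is_path V E f g fs}"

definition descendant_space ::
  "'n bpoly set \<Rightarrow> ('n bpoly \<times> 'n bpoly) set \<Rightarrow> 'n bpoly \<Rightarrow> 'n bpoly set" where
  "descendant_space V E f = bpoly_vs.span (descendants V E f)"

end

theory Submission
  imports Defs
begin

text \<open>
  An ideal of \<open>\<bbbB>\<^sub>n\<close> consists of all polynomials that vanish on its zero set, so membership in
  \<open>I\<^sub>F\<close> is tested at the satisfying assignments of \<open>F\<close>. There, an edge \<open>(f, g)\<close> means that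
  \<open>f = 0\<close> implies \<open>g = 0\<close>. This passes along paths to all descendants of \<open>f\<close>, and by
  linearity to \<open>\<Delta>\<^sub>f\<close>; the three claims are then case distinctions on values in \<open>\<bbbF>\<^sub>2\<close>.
\<close>

lemma mem_xnf_ideal_iff:
  "p \<in> xnf_ideal F \<longleftrightarrow> (\<forall>a. satisfies a F \<longrightarrow> bpoly_eval a p = 0)"
  using ideal_eq_vanishing[OF xnf_ideal_props(1)[of F]] xnf_ideal_props(2)[of F] by blast

lemma bpoly_eval_bscale [simp]: "bpoly_eval a (bscale c p) = c * bpoly_eval a p"
  by transfer (simp only: mpoly_eval_mult mpoly_eval_single keys_zero prod.empty mult_1_right)

lemma bpoly_eval_span_eq_0:
  assumes "g \<in> bpoly_vs.span S" "\<And>p. p \<in> S \<Longrightarrow> bpoly_eval a p = 0"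
  shows "bpoly_eval a g = 0"
  using assms by (induction rule: bpoly_vs.span_induct_alt) simp_all

lemma igs_edge_eval:
  assumes "is_igs F L V E" "(f, g) \<in> E" "satisfies a F" "bpoly_eval a f = 0"
  shows "bpoly_eval a g = 0"
proof -
  let ?M = "{f * g | f g. (f + 1, g) \<in> E}"
  \<comment> \<open>Generators come from edges written \<open>(f + 1, g)\<close>; in characteristic
    2 the edge \<open>(f, g)\<close> has this shape with \<open>f + 1\<close> for \<open>f\<close>,
    which gives the generator \<open>(f + 1) * g\<close>.\<close>
  have "f + 1 + 1 = f"
    by (simp only: add.assoc bpoly_char2 add_0_right)
  then have "(f + 1) * g \<in> ring_mod.span ?M"
    using assms(2) by (intro ring_mod.span_base) force
  moreover have "xnf_ideal F = {p + q | p q. p \<in> ring_mod.span L \<and> q \<in> ring_mod.span ?M}"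
    using assms(1) unfolding is_igs_def by blast
  \<comment> \<open>The summand from the span of \<open>L\<close> is 0.\<close>
  ultimately have "(f + 1) * g \<in> xnf_ideal F"
    using ring_mod.span_zero[of L] add_0_left[of "(f + 1) * g"] by (smt (verit) mem_Collect_eq)
  then have "bpoly_eval a ((f + 1) * g) = 0"
    using assms(3) by (simp only: mem_xnf_ideal_iff)
  then show ?thesis
    using assms(4) by simp
qed

lemma igs_path_eval:
  assumes "is_igs F L V E" "is_path V E f g fs" "satisfies a F" "bpoly_eval a f = 0"
  shows "bpoly_eval a g = 0"
proof -
  have "bpoly_eval a (fs ! i) = 0" if "i < length fs" for i
    using that
  proof (induction i)
    case 0
    then show ?case
      using assms by (simp add: is_path_def hd_conv_nth)
  next
    case (Suc i)
    then show ?case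
      using assms by (auto simp: is_path_def intro: igs_edge_eval)
  qed
  then show ?thesis
    using assms(2) by (auto simp: is_path_def last_conv_nth)
qed

text \<open>Stated for arbitrary \<open>f\<close>, so that it also applies to \<open>f + 1\<close>,
  which may lie outside \<open>V\<close>.\<close>

lemma igs_descendant_space_eval:
  assumes "is_igs F L V E" "g \<in> descendant_space V E f" "satisfies a F" "bpoly_eval a f = 0"
  shows "bpoly_eval a g = 0"
  using assms(2) unfolding descendant_space_def
  by (rule bpoly_eval_span_eq_0) (auto simp: descendants_def assms(4) intro: igs_path_eval assms)

theorem proposition4p10:
  fixes F :: "'n::finite xnf"
    and L V :: "'n bpoly set"
    and E :: "('n bpoly \<times> 'n bpoly) set"
  assumes "is_2xnf F"
    and "is_igs F L V E"
  shows "(\<forall>f\<in>V. \<forall>g\<in>descendant_space V E f. (f + 1) * g \<in> xnf_ideal F) \<and>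
    (\<forall>f\<in>V. \<forall>g\<in>V.
       descendant_space V E f \<inter> {u + 1 | u. u \<in> descendant_space V E g} \<noteq> {} \<longrightarrow>
       (f + 1) * (g + 1) \<in> xnf_ideal F) \<and>
    (\<forall>f\<in>V. descendant_space V E f \<inter> descendant_space V E (f + 1) \<subseteq> xnf_ideal F)"
proof (intro conjI ballI impI subsetI)
  fix f g
  assume g: "g \<in> descendant_space V E f"
  \<comment> \<open>Where \<open>f\<close> is 1, the factor \<open>f + 1\<close> vanishes; where
    \<open>f\<close> is 0, so is \<open>g\<close>.\<close>
  have "bpoly_eval a ((f + 1) * g) = 0" if "satisfies a F" for a
    using igs_descendant_space_eval[OF assms(2) g that] by (cases "bpoly_eval a f") simp_all
  then show "(f + 1) * g \<in> xnf_ideal F"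
    by (simp only: mem_xnf_ideal_iff) blast
next
  fix f g
  assume "descendant_space V E f \<inter> {u + 1 | u. u \<in> descendant_space V E g} \<noteq> {}"
  then obtain u where u: "u + 1 \<in> descendant_space V E f" "u \<in> descendant_space V E g"
    by blast
  \<comment> \<open>If \<open>f\<close> and \<open>g\<close> both vanished at \<open>a\<close>, so
    would \<open>u + 1\<close> and \<open>u\<close>, which is absurd.\<close>
  have "bpoly_eval a ((f + 1) * (g + 1)) = 0" if "satisfies a F" for a
    using igs_descendant_space_eval[OF assms(2) u(1) that]
      igs_descendant_space_eval[OF assms(2) u(2) that]
    by (cases "bpoly_eval a f"; cases "bpoly_eval a g") simp_all
  then show "(f + 1) * (g + 1) \<in> xnf_ideal F"
    by (simp only: mem_xnf_ideal_iff) blast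
next
  fix f h
  assume "h \<in> descendant_space V E f \<inter> descendant_space V E (f + 1)"
  then have h: "h \<in> descendant_space V E f" "h \<in> descendant_space V E (f + 1)"
    by simp_all
  \<comment> \<open>One of \<open>f\<close> and \<open>f + 1\<close> vanishes at \<open>a\<close>,
    and either one forces \<open>h\<close> to vanish.\<close>
  have "bpoly_eval a h = 0" if "satisfies a F" for a
    using igs_descendant_space_eval[OF assms(2) h(1) that]
      igs_descendant_space_eval[OF assms(2) h(2) that]
    by (cases "bpoly_eval a f") simp_all
  then show "h \<in> xnf_ideal F"
    by (simp only: mem_xnf_ideal_iff) blast
qed

end
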